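(* Consider data $(U_i,X_{i1},\dots,X_{id},Y_i)$, $i=1,\dots,n$, from the varying coefficient model $Y=\sum_{k=1}^d a_k(U)X_k+\sigma(U)\varepsilon$ with $X_1=1$, and local polynomial fitting of degree $p\ge 0$ at a grid point $u$ with kernel $K$ and bandwidth $h$. Then the following exact, finite-sample ANOVA decomposition holds: $$SST(u;h)=SSE_p(u;h)+SSR_p(u;h),$$ where $$SST(u;h)=\frac{n^{-1}\sum_{i=1}^n(Y_i-\bar Y)^2K_h(U_i-u)}{\hat g(u;h)},$$ $$SSE_p(u;h)=\frac{n^{-1}\sum_{i=1}^n(Y_i-\hat Y_i(u))^2K_h(U_i-u)}{\hat g(u;h)},\qquad SSR_p(u;h)=\frac{n^{-1}\sum_{i=1}^n(\hat Y_i(u)-\bar Y)^2K_h(U_i-u)}{\hat g(u;h)},$$ and $\hat Y_i(u)=e_{ni}\mathbf X_u(\mathbf X_u^TW_u\mathbf X_u)^{-1}\mathbf X_u^TW_u\mathbf y=\sum_{k=1}^d\sum_{j=0}^p\hat\beta_{k,j}(U_i-u)^jX_{ik}$, with $e_{ni}$ the $n$-dimensional (row) vector with $1$ at the $i$th position and $0$ elsewhere.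
   Context: In the model, $d\ge1$, $X_1,\dots,X_d$ are covariates with $X_1=1$ (so $X_{i1}=1$ for all $i$), $U$ and $\varepsilon$ are independent, and $\varepsilon$ has mean $0$ and unit variance. $\mathbf y=(Y_1,\dots,Y_n)^T$, $\bar Y=n^{-1}\sum_iY_i$. $K$ is a nonnegative kernel, $h>0$, $K_h(\cdot)=K(\cdot/h)/h$, and $\hat g(u;h)=n^{-1}\sum_{i=1}^nK_h(U_i-u)$. $\mathbf X_u$ is the $n\times(p+1)d$ matrix whose $i$th row is $$\big(X_{i1},X_{i1}(U_i-u),\dots,X_{i1}(U_i-u)^p,\;\dots,\;X_{id},X_{id}(U_i-u),\dots,X_{id}(U_i-u)^p\big),$$ and $W_u$ is the $n\times n$ diagonal matrix with $i$th diagonal entry $K_h(U_i-u)/\hat g(u;h)$. The fit $$\hat\beta(u)=(\hat\beta_{1,0},\dots,\hat\beta_{1,p},\dots,\hat\beta_{d,0},\dots,\hat\beta_{d,p})^T=(\mathbf X_u^TW_u\mathbf X_u)^{-1}\mathbf X_u^TW_u\mathbf y$$ is the solution of $\min_\beta n^{-1}\sum_{i=1}^n\big(Y_i-\sum_{k=1}^d\sum_{j=0}^p\beta_{k,j}(U_i-u)^jX_{ik}\big)^2K_h(U_i-u)/\hat g(u;h)$. (The quantities are defined when $\hat g(u;h)\neq0$ and $\mathbf X_u^TW_u\mathbf X_u$ is invertible.) *)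

theory Defs
  imports
    "HOL-Probability.Probability"
    "Jordan_Normal_Form.Gauss_Jordan_Elimination"
begin

(* Observations i, covariates k and polynomial powers j are all numbered from 0, so the
   first covariate X_1 = 1 of the model is X i 0 here.  The observations are not assumed
   to be independent of one another or identically distributed; a random sample is the
   special case in which they are. *)
definition varying_coefficient_sample ::
  "'w measure \<Rightarrow> nat \<Rightarrow> nat \<Rightarrow> (nat \<Rightarrow> real \<Rightarrow> real) \<Rightarrow> (real \<Rightarrow> real) \<Rightarrow>
   (nat \<Rightarrow> 'w \<Rightarrow> real) \<Rightarrow> (nat \<Rightarrow> nat \<Rightarrow> 'w \<Rightarrow> real) \<Rightarrow> (nat \<Rightarrow> 'w \<Rightarrow> real) \<Rightarrow>
   (nat \<Rightarrow> 'w \<Rightarrow> real) \<Rightarrow> bool" where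
  "varying_coefficient_sample M n d a \<sigma> U X \<epsilon> Y \<longleftrightarrow>
     prob_space M \<and> 1 \<le> d \<and>
     (\<forall>i<n.
        U i \<in> borel_measurable M \<and> \<epsilon> i \<in> borel_measurable M \<and> Y i \<in> borel_measurable M \<and>
        (\<forall>k<d. X i k \<in> borel_measurable M) \<and>
        (\<forall>\<omega>\<in>space M. X i 0 \<omega> = 1) \<and>
        prob_space.indep_var M borel (U i) borel (\<epsilon> i) \<and>
        integrable M (\<epsilon> i) \<and> prob_space.expectation M (\<epsilon> i) = 0 \<and>
        prob_space.variance M (\<epsilon> i) = 1 \<and>
        (\<forall>\<omega>\<in>space M.
           Y i \<omega> = (\<Sum>k<d. a k (U i \<omega>) * X i k \<omega>) + \<sigma> (U i \<omega>) * \<epsilon> i \<omega>))"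

definition scaled_kernel :: "(real \<Rightarrow> real) \<Rightarrow> real \<Rightarrow> real \<Rightarrow> real" where
  "scaled_kernel K h t = K (t / h) / h"

definition g_hat :: "nat \<Rightarrow> (real \<Rightarrow> real) \<Rightarrow> real \<Rightarrow> real \<Rightarrow> (nat \<Rightarrow> real) \<Rightarrow> real" where
  "g_hat n K h u U = (\<Sum>i<n. scaled_kernel K h (U i - u)) / real n"

(* Column k * (p + 1) + j belongs to covariate k and power j. *)
definition design_matrix ::
  "nat \<Rightarrow> nat \<Rightarrow> nat \<Rightarrow> real \<Rightarrow> (nat \<Rightarrow> real) \<Rightarrow> (nat \<Rightarrow> nat \<Rightarrow> real) \<Rightarrow> real mat" where
  "design_matrix n d p u U X =
     Matrix.mat n ((p + 1) * d)
       (\<lambda>(i, c). X i (c div (p + 1)) * (U i - u) ^ (c mod (p + 1)))"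

definition weight_matrix ::
  "nat \<Rightarrow> (real \<Rightarrow> real) \<Rightarrow> real \<Rightarrow> real \<Rightarrow> (nat \<Rightarrow> real) \<Rightarrow> real mat" where
  "weight_matrix n K h u U =
     mat_diag n (\<lambda>i. scaled_kernel K h (U i - u) / g_hat n K h u U)"

definition gram_matrix ::
  "nat \<Rightarrow> nat \<Rightarrow> nat \<Rightarrow> (real \<Rightarrow> real) \<Rightarrow> real \<Rightarrow> real \<Rightarrow>
   (nat \<Rightarrow> real) \<Rightarrow> (nat \<Rightarrow> nat \<Rightarrow> real) \<Rightarrow> real mat" where
  "gram_matrix n d p K h u U X =
     transpose_mat (design_matrix n d p u U X) * weight_matrix n K h u U *
       design_matrix n d p u U X"

(* (X^T W X)^{-1} X^T W y; meaningful only when the Gram matrix is invertible, since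
   otherwise mat_inverse returns None. *)
definition beta_hat ::
  "nat \<Rightarrow> nat \<Rightarrow> nat \<Rightarrow> (real \<Rightarrow> real) \<Rightarrow> real \<Rightarrow> real \<Rightarrow>
   (nat \<Rightarrow> real) \<Rightarrow> (nat \<Rightarrow> nat \<Rightarrow> real) \<Rightarrow> (nat \<Rightarrow> real) \<Rightarrow> real Matrix.vec" where
  "beta_hat n d p K h u U X Y =
     (the (mat_inverse (gram_matrix n d p K h u U X)) *
       transpose_mat (design_matrix n d p u U X) * weight_matrix n K h u U)
     *\<^sub>v Matrix.vec n Y"

definition beta_hat_coeff ::
  "nat \<Rightarrow> nat \<Rightarrow> nat \<Rightarrow> (real \<Rightarrow> real) \<Rightarrow> real \<Rightarrow> real \<Rightarrow>
   (nat \<Rightarrow> real) \<Rightarrow> (nat \<Rightarrow> nat \<Rightarrow> real) \<Rightarrow> (nat \<Rightarrow> real) \<Rightarrow> nat \<Rightarrow> nat \<Rightarrow> real" where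
  "beta_hat_coeff n d p K h u U X Y k j =
     vec_index (beta_hat n d p K h u U X Y) (k * (p + 1) + j)"

definition Y_hat ::
  "nat \<Rightarrow> nat \<Rightarrow> nat \<Rightarrow> (real \<Rightarrow> real) \<Rightarrow> real \<Rightarrow> real \<Rightarrow>
   (nat \<Rightarrow> real) \<Rightarrow> (nat \<Rightarrow> nat \<Rightarrow> real) \<Rightarrow> (nat \<Rightarrow> real) \<Rightarrow> nat \<Rightarrow> real" where
  "Y_hat n d p K h u U X Y i =
     scalar_prod (unit_vec n i)
       ((design_matrix n d p u U X * the (mat_inverse (gram_matrix n d p K h u U X)) *
           transpose_mat (design_matrix n d p u U X) * weight_matrix n K h u U)
         *\<^sub>v Matrix.vec n Y)"

definition Y_bar :: "nat \<Rightarrow> (nat \<Rightarrow> real) \<Rightarrow> real" where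
  "Y_bar n Y = (\<Sum>i<n. Y i) / real n"

definition SST ::
  "nat \<Rightarrow> (real \<Rightarrow> real) \<Rightarrow> real \<Rightarrow> real \<Rightarrow> (nat \<Rightarrow> real) \<Rightarrow> (nat \<Rightarrow> real) \<Rightarrow> real" where
  "SST n K h u U Y =
     ((\<Sum>i<n. (Y i - Y_bar n Y)\<^sup>2 * scaled_kernel K h (U i - u)) / real n) / g_hat n K h u U"

definition SSE ::
  "nat \<Rightarrow> nat \<Rightarrow> nat \<Rightarrow> (real \<Rightarrow> real) \<Rightarrow> real \<Rightarrow> real \<Rightarrow>
   (nat \<Rightarrow> real) \<Rightarrow> (nat \<Rightarrow> nat \<Rightarrow> real) \<Rightarrow> (nat \<Rightarrow> real) \<Rightarrow> real" where
  "SSE n d p K h u U X Y =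
     ((\<Sum>i<n. (Y i - Y_hat n d p K h u U X Y i)\<^sup>2 * scaled_kernel K h (U i - u)) / real n)
       / g_hat n K h u U"

definition SSR ::
  "nat \<Rightarrow> nat \<Rightarrow> nat \<Rightarrow> (real \<Rightarrow> real) \<Rightarrow> real \<Rightarrow> real \<Rightarrow>
   (nat \<Rightarrow> real) \<Rightarrow> (nat \<Rightarrow> nat \<Rightarrow> real) \<Rightarrow> (nat \<Rightarrow> real) \<Rightarrow> real" where
  "SSR n d p K h u U X Y =
     ((\<Sum>i<n. (Y_hat n d p K h u U X Y i - Y_bar n Y)\<^sup>2 * scaled_kernel K h (U i - u)) / real n)
       / g_hat n K h u U"

end

theory Submission
  imports Defs
begin

text \<open>
  At a fixed sample point the identity is Pythagoras' theorem for the bilinear form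
  \<open>\<langle>v, r\<rangle> = v\<^sup>T W r\<close> given by the kernel weights. The fitted vector is
  \<open>H y\<close> with \<open>H = X (X\<^sup>T W X)\<^sup>-\<^sup>1 X\<^sup>T W\<close>, and the normal equations
  \<open>X\<^sup>T W (y - H y) = 0\<close> say that the residual is orthogonal to the column space of \<open>X\<close>
  (\<open>weighted_residual_orthogonal\<close>). Besides \<open>H y\<close> that space contains the constant
  vectors, because the column of the intercept covariate with power 0 consists of ones. Hence
  \<open>H y - c\<close> is orthogonal to \<open>y - H y\<close> for every constant \<open>c\<close>, and the cross term vanishes when
  \<open>(y - c)\<^sup>2 = ((y - H y) + (H y - c))\<^sup>2\<close> is summed against the weights. The
  theorem is the case \<open>c = Y_bar\<close>.

  The expression of the fitted values through local polynomial coefficients is the product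
  \<open>X \<beta>\<close> written out, with the single column index split by \<open>div\<close> and \<open>mod\<close> into
  covariate and power.
\<close>

section \<open>Weighted least squares\<close>

lemma mat_inverse_right_inverse:
  fixes A :: "'a :: field mat"
  assumes A: "A \<in> carrier_mat m m" and inv: "invertible_mat A"
  shows "the (mat_inverse A) \<in> carrier_mat m m" and "A * the (mat_inverse A) = 1\<^sub>m m"
proof -
  obtain B where AB: "A * B = 1\<^sub>m m" and BA: "B * A = 1\<^sub>m (dim_row B)"
    using inv A unfolding invertible_mat_def inverts_mat_def by auto
  have "dim_col B = m"
    using arg_cong[OF AB, of dim_col] by simp
  moreover have "dim_row B = m"
    using arg_cong[OF BA, of dim_col] A by simp
  ultimately have B: "B \<in> carrier_mat m m"
    by auto
  have "A \<in> Units (ring_mat TYPE('a) m ())"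
    using A B AB BA by (auto simp: Units_def ring_mat_def intro!: bexI[of _ B])
  then obtain C where C: "mat_inverse A = Some C"
    using mat_inverse(1)[OF A] by fastforce
  show "the (mat_inverse A) \<in> carrier_mat m m" "A * the (mat_inverse A) = 1\<^sub>m m"
    using mat_inverse(2)[OF A C] C by auto
qed

text \<open>
  With \<open>\<beta> = B D\<^sup>T W y\<close> the hypothesis on \<open>B\<close> gives \<open>D\<^sup>T W D \<beta> = D\<^sup>T W y\<close>, so
  \<open>D\<^sup>T\<close> annihilates \<open>W (y - D \<beta>)\<close>; transposing moves this to any vector \<open>D v\<close> of the
  column space.
\<close>

lemma weighted_residual_orthogonal:
  fixes D W B :: "'a :: comm_ring_1 mat"
  assumes D: "D \<in> carrier_mat n m" and W: "W \<in> carrier_mat n n" and B: "B \<in> carrier_mat m m"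
    and right_inverse: "transpose_mat D * W * D * B = 1\<^sub>m m"
    and y: "y \<in> carrier_vec n" and v: "v \<in> carrier_vec m"
  shows "scalar_prod (D *\<^sub>v v) (W *\<^sub>v (y - (D * B * transpose_mat D * W) *\<^sub>v y)) = 0"
proof -
  define T where "T = transpose_mat D"
  define z where "z = T *\<^sub>v (W *\<^sub>v y)"
  have T: "T \<in> carrier_mat m n"
    using D by (simp add: T_def)
  have Wy: "W *\<^sub>v y \<in> carrier_vec n" and z: "z \<in> carrier_vec m"
    using W T y by (auto simp: z_def)
  have Bz: "B *\<^sub>v z \<in> carrier_vec m"
    using B z by simp
  have DBz: "D *\<^sub>v (B *\<^sub>v z) \<in> carrier_vec n"
    using D Bz by simp
  have fit: "(D * B * T * W) *\<^sub>v y = D *\<^sub>v (B *\<^sub>v z)"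
  proof -
    have "(D * B * T * W) *\<^sub>v y = (D * B * T) *\<^sub>v (W *\<^sub>v y)"
      by (rule assoc_mult_mat_vec[of _ n n _ n]) (use D B T W y in auto)
    also have "\<dots> = (D * B) *\<^sub>v z"
      unfolding z_def by (rule assoc_mult_mat_vec[of _ n m _ n]) (use D B T Wy in auto)
    also have "\<dots> = D *\<^sub>v (B *\<^sub>v z)"
      by (rule assoc_mult_mat_vec[OF D B z])
    finally show ?thesis .
  qed
  have "T *\<^sub>v (W *\<^sub>v (D *\<^sub>v (B *\<^sub>v z))) = (T * W * D * B) *\<^sub>v z"
  proof -
    have "(T * W * D * B) *\<^sub>v z = (T * W * D) *\<^sub>v (B *\<^sub>v z)"
      by (rule assoc_mult_mat_vec[of _ m m _ m]) (use D B T W z in auto)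
    also have "\<dots> = (T * W) *\<^sub>v (D *\<^sub>v (B *\<^sub>v z))"
      by (rule assoc_mult_mat_vec[of _ m n _ m]) (use D T W Bz in auto)
    also have "\<dots> = T *\<^sub>v (W *\<^sub>v (D *\<^sub>v (B *\<^sub>v z)))"
      by (rule assoc_mult_mat_vec[OF T W DBz])
    finally show ?thesis by simp
  qed
  also have "\<dots> = z"
    using right_inverse z by (simp add: T_def)
  finally have normal_equations: "T *\<^sub>v (W *\<^sub>v (D *\<^sub>v (B *\<^sub>v z))) = z" .
  have "T *\<^sub>v (W *\<^sub>v (y - D *\<^sub>v (B *\<^sub>v z))) =
      T *\<^sub>v (W *\<^sub>v y) - T *\<^sub>v (W *\<^sub>v (D *\<^sub>v (B *\<^sub>v z)))"
    using T W y Wy DBz by (simp add: mult_minus_distrib_mat_vec)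
  then have zero: "T *\<^sub>v (W *\<^sub>v (y - D *\<^sub>v (B *\<^sub>v z))) = 0\<^sub>v m"
    using normal_equations z by (simp add: z_def[symmetric])
  let ?r = "W *\<^sub>v (y - D *\<^sub>v (B *\<^sub>v z))"
  have r: "?r \<in> carrier_vec n"
    using W y DBz by simp
  have "scalar_prod (D *\<^sub>v v) ?r = scalar_prod ?r (D *\<^sub>v v)"
    by (rule comm_scalar_prod[of _ n]) (use D v r in auto)
  also have "\<dots> = scalar_prod (T *\<^sub>v ?r) v"
    unfolding T_def by (rule transpose_vec_mult_scalar[OF D v r, symmetric])
  also have "\<dots> = 0"
    using zero v by simp
  finally show ?thesis
    using fit by (simp add: T_def)
qed

lemma mat_diag_mult_vec:
  fixes w :: "nat \<Rightarrow> 'a :: semiring_0"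
  assumes "r \<in> carrier_vec n"
  shows "mat_diag n w *\<^sub>v r = Matrix.vec n (\<lambda>i. w i * vec_index r i)"
proof (rule eq_vecI)
  fix i assume "i < dim_vec (Matrix.vec n (\<lambda>i. w i * vec_index r i))"
  then have i: "i < n" by simp
  have "vec_index (mat_diag n w *\<^sub>v r) i =
      (\<Sum>j\<in>{0..<n}. (if i = j then w j else 0) * vec_index r j)"
    using i assms by (auto simp: mat_diag_def mult_mat_vec_def scalar_prod_def intro!: sum.cong)
  also have "\<dots> = (\<Sum>j\<in>{0..<n}. if i = j then w j * vec_index r j else 0)"
    by (intro sum.cong) auto
  also have "\<dots> = w i * vec_index r i"
    using i by simp
  finally show "vec_index (mat_diag n w *\<^sub>v r) i =
      vec_index (Matrix.vec n (\<lambda>i. w i * vec_index r i)) i"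
    using i by simp
qed (simp add: mat_diag_def)

lemma weighted_sum_of_squares_decomposition:
  fixes y f w :: "'i \<Rightarrow> 'a :: comm_ring_1"
  assumes "(\<Sum>i\<in>I. (f i - c) * (w i * (y i - f i))) = 0"
  shows "(\<Sum>i\<in>I. (y i - c)\<^sup>2 * w i) =
    (\<Sum>i\<in>I. (y i - f i)\<^sup>2 * w i) + (\<Sum>i\<in>I. (f i - c)\<^sup>2 * w i)"
proof -
  have "(\<Sum>i\<in>I. (y i - c)\<^sup>2 * w i) = (\<Sum>i\<in>I. (y i - f i)\<^sup>2 * w i + (f i - c)\<^sup>2 * w i
      + 2 * ((f i - c) * (w i * (y i - f i))))"
    by (intro sum.cong) (auto simp: power2_eq_square algebra_simps)
  then show ?thesis
    using assms by (simp add: sum.distrib sum_distrib_left[symmetric])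
qed

section \<open>The local polynomial fit\<close>

lemma sum_lessThan_mult_blocks:
  fixes f :: "nat \<Rightarrow> 'a :: comm_monoid_add"
  shows "(\<Sum>c<q * d. f c) = (\<Sum>k<d. \<Sum>j<q. f (k * q + j))"
proof -
  have "(\<Sum>c<q * d. f c) = (\<Sum>k<d. sum f {k * q..<k * q + q})"
    by (simp add: sum.nat_group mult.commute)
  also have "\<dots> = (\<Sum>k<d. \<Sum>j<q. f (k * q + j))"
  proof (rule sum.cong[OF refl])
    fix k
    show "sum f {k * q..<k * q + q} = (\<Sum>j<q. f (k * q + j))"
      using sum.shift_bounds_nat_ivl[of f 0 "k * q" q]
      by (simp add: lessThan_atLeast0 add.commute)
  qed
  finally show ?thesis .
qed

lemma design_matrix_carrier: "design_matrix n d p u U X \<in> carrier_mat n ((p + 1) * d)"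
  by (simp add: design_matrix_def)

lemma weight_matrix_carrier: "weight_matrix n K h u U \<in> carrier_mat n n"
  by (simp add: weight_matrix_def)

lemma gram_matrix_carrier:
  "gram_matrix n d p K h u U X \<in> carrier_mat ((p + 1) * d) ((p + 1) * d)"
  unfolding gram_matrix_def
  by (intro mult_carrier_mat[of _ _ n] transpose_carrier_mat[THEN iffD2]
      design_matrix_carrier weight_matrix_carrier)

context
  fixes n d p :: nat and K :: "real \<Rightarrow> real" and h u :: real
    and U :: "nat \<Rightarrow> real" and X :: "nat \<Rightarrow> nat \<Rightarrow> real" and Y :: "nat \<Rightarrow> real"
  assumes invertible: "invertible_mat (gram_matrix n d p K h u U X)"
begin

lemma beta_hat_carrier: "beta_hat n d p K h u U X Y \<in> carrier_vec ((p + 1) * d)"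
proof (rule carrier_vecI)
  show "dim_vec (beta_hat n d p K h u U X Y) = (p + 1) * d"
    unfolding beta_hat_def dim_mult_mat_vec index_mult_mat
    by (rule carrier_matD(1)[OF mat_inverse_right_inverse(1)[OF gram_matrix_carrier invertible]])
qed

lemma hat_matrix_mult_vec:
  "(design_matrix n d p u U X * the (mat_inverse (gram_matrix n d p K h u U X)) *
      transpose_mat (design_matrix n d p u U X) * weight_matrix n K h u U) *\<^sub>v Matrix.vec n Y
    = design_matrix n d p u U X *\<^sub>v beta_hat n d p K h u U X Y"
proof -
  let ?m = "(p + 1) * d"
  let ?D = "design_matrix n d p u U X" and ?W = "weight_matrix n K h u U"
  let ?B = "the (mat_inverse (gram_matrix n d p K h u U X))"
  note D = design_matrix_carrier[of n d p u U X] and W = weight_matrix_carrier[of n K h u U]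
    and B = mat_inverse_right_inverse(1)[OF gram_matrix_carrier invertible]
  have T: "transpose_mat ?D \<in> carrier_mat ?m n"
    using D by simp
  have BT: "?B * transpose_mat ?D \<in> carrier_mat ?m n"
    by (rule mult_carrier_mat[OF B T])
  have "?D * ?B * transpose_mat ?D * ?W = ?D * (?B * transpose_mat ?D * ?W)"
    by (simp only: assoc_mult_mat[OF D B T] assoc_mult_mat[OF D BT W])
  moreover have "?B * transpose_mat ?D * ?W \<in> carrier_mat ?m n"
    by (rule mult_carrier_mat[OF BT W])
  ultimately show ?thesis
    unfolding beta_hat_def by (simp add: assoc_mult_mat_vec[OF D])
qed

lemma Y_hat_eq:
  assumes "i < n"
  shows "Y_hat n d p K h u U X Y i =
    vec_index (design_matrix n d p u U X *\<^sub>v beta_hat n d p K h u U X Y) i"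
  unfolding Y_hat_def hat_matrix_mult_vec
  by (rule scalar_prod_left_unit
      [OF mult_mat_vec_carrier[OF design_matrix_carrier beta_hat_carrier] assms])

lemma Y_hat_local_polynomial:
  assumes i: "i < n"
  shows "Y_hat n d p K h u U X Y i =
    (\<Sum>k<d. \<Sum>j\<le>p. beta_hat_coeff n d p K h u U X Y k j * (U i - u) ^ j * X i k)"
proof -
  let ?b = "vec_index (beta_hat n d p K h u U X Y)"
  let ?x = "\<lambda>c. X i (c div (p + 1)) * (U i - u) ^ (c mod (p + 1))"
  have "Y_hat n d p K h u U X Y i = (\<Sum>c<(p + 1) * d. ?x c * ?b c)"
    unfolding Y_hat_eq[OF i] using i carrier_vecD[OF beta_hat_carrier]
    by (simp add: mult_mat_vec_def design_matrix_def scalar_prod_def lessThan_atLeast0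
        del: mult_Suc add_mult_distrib)
  also have "\<dots> = (\<Sum>k<d. \<Sum>j<p + 1. ?x (k * (p + 1) + j) * ?b (k * (p + 1) + j))"
    by (rule sum_lessThan_mult_blocks)
  also have "\<dots> =
      (\<Sum>k<d. \<Sum>j<p + 1. beta_hat_coeff n d p K h u U X Y k j * (U i - u) ^ j * X i k)"
  proof (intro sum.cong refl)
    fix k j assume "j \<in> {..<p + 1}"
    then have "j < p + 1"
      by simp
    then have "(k * (p + 1) + j) div (p + 1) = k" "(k * (p + 1) + j) mod (p + 1) = j"
      by (simp_all only: div_mult_self3 mod_mult_self3 div_less mod_less)
    then show "?x (k * (p + 1) + j) * ?b (k * (p + 1) + j) =
        beta_hat_coeff n d p K h u U X Y k j * (U i - u) ^ j * X i k"
      unfolding beta_hat_coeff_def by (simp only: ac_simps)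
  qed
  finally show ?thesis
    by (simp add: lessThan_Suc_atMost)
qed

text \<open>
  Subtracting \<open>c\<close> from the fitted values only changes the intercept coefficient, so the
  centred fit is again a vector of the column space.
\<close>

lemma centred_fit_orthogonal_residual:
  assumes d: "1 \<le> d" and intercept: "\<And>i. i < n \<Longrightarrow> X i 0 = 1"
  shows "(\<Sum>i<n. (Y_hat n d p K h u U X Y i - c) *
    (scaled_kernel K h (U i - u) / g_hat n K h u U * (Y i - Y_hat n d p K h u U X Y i))) = 0"
proof -
  let ?m = "(p + 1) * d"
  let ?D = "design_matrix n d p u U X" and ?W = "weight_matrix n K h u U"
  let ?b = "beta_hat n d p K h u U X Y"
  let ?f = "Y_hat n d p K h u U X Y"
  let ?v = "?b - c \<cdot>\<^sub>v unit_vec ?m 0"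
  note D = design_matrix_carrier[of n d p u U X] and W = weight_matrix_carrier[of n K h u U]
  note b = beta_hat_carrier
  have m: "0 < ?m"
    using d by simp
  have v: "?v \<in> carrier_vec ?m"
    using b by simp
  \<comment> \<open>Column 0 belongs to the intercept covariate and power 0.\<close>
  have ones: "?D *\<^sub>v unit_vec ?m 0 = Matrix.vec n (\<lambda>_. 1)"
    using m D intercept
    by (intro eq_vecI)
      (auto simp: mult_mat_vec_def design_matrix_def scalar_prod_right_unit[OF m])
  have fit: "?D *\<^sub>v ?b = Matrix.vec n ?f"
    by (rule eq_vecI)
      (simp_all only: dim_vec index_vec Y_hat_eq dim_mult_mat_vec carrier_matD(1)[OF D])
  have Dv: "?D *\<^sub>v ?v = Matrix.vec n (\<lambda>i. ?f i - c)"
  proof -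
    have "?D *\<^sub>v ?v = ?D *\<^sub>v ?b - c \<cdot>\<^sub>v (?D *\<^sub>v unit_vec ?m 0)"
      by (subst mult_minus_distrib_mat_vec[OF D b])
        (simp_all only: mult_mat_vec[OF D unit_vec_carrier] smult_carrier_vec unit_vec_carrier)
    also have "\<dots> = ?D *\<^sub>v ?b - c \<cdot>\<^sub>v Matrix.vec n (\<lambda>_. 1)"
      by (simp only: ones)
    also have "\<dots> = Matrix.vec n (\<lambda>i. ?f i - c)"
      unfolding fit by (intro eq_vecI) simp_all
    finally show ?thesis .
  qed
  have residual: "Matrix.vec n Y - ?D *\<^sub>v ?b = Matrix.vec n (\<lambda>i. Y i - ?f i)"
    unfolding fit by (intro eq_vecI) simp_all
  note B = mat_inverse_right_inverse(1)[OF gram_matrix_carrier invertible]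
  have right_inverse: "transpose_mat ?D * ?W * ?D *
      the (mat_inverse (gram_matrix n d p K h u U X)) = 1\<^sub>m ?m"
    unfolding gram_matrix_def[symmetric]
    by (rule mat_inverse_right_inverse(2)[OF gram_matrix_carrier invertible])
  have "scalar_prod (?D *\<^sub>v ?v) (?W *\<^sub>v (Matrix.vec n Y - ?D *\<^sub>v ?b)) = 0"
    unfolding hat_matrix_mult_vec[symmetric]
    by (rule weighted_residual_orthogonal[OF D W B right_inverse vec_carrier v])
  then show ?thesis
    unfolding Dv residual weight_matrix_def mat_diag_mult_vec[OF vec_carrier]
    by (simp add: scalar_prod_def lessThan_atLeast0)
qed

lemma SST_eq_SSE_plus_SSR:
  assumes d: "1 \<le> d" and intercept: "\<And>i. i < n \<Longrightarrow> X i 0 = 1"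
    and g: "g_hat n K h u U \<noteq> 0"
  shows "SST n K h u U Y = SSE n d p K h u U X Y + SSR n d p K h u U X Y"
proof -
  have "(\<Sum>i<n. (Y_hat n d p K h u U X Y i - Y_bar n Y) *
      (scaled_kernel K h (U i - u) * (Y i - Y_hat n d p K h u U X Y i))) / g_hat n K h u U = 0"
    using centred_fit_orthogonal_residual[OF d intercept, of "Y_bar n Y"]
    by (simp add: sum_divide_distrib)
  then have "(\<Sum>i<n. (Y_hat n d p K h u U X Y i - Y_bar n Y) *
      (scaled_kernel K h (U i - u) * (Y i - Y_hat n d p K h u U X Y i))) = 0"
    using g by simp
  \<comment> \<open>The common factor \<open>1 / g_hat\<close> of the weights has been cleared above, so the
    decomposition is applied with the raw kernel values.\<close>
  from weighted_sum_of_squares_decomposition[OF this] show ?thesis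
    by (simp add: SST_def SSE_def SSR_def add_divide_distrib)
qed

end

theorem theorem5:
  fixes M :: "'w measure" and n d p :: nat
    and a :: "nat \<Rightarrow> real \<Rightarrow> real" and \<sigma> :: "real \<Rightarrow> real"
    and U :: "nat \<Rightarrow> 'w \<Rightarrow> real" and X :: "nat \<Rightarrow> nat \<Rightarrow> 'w \<Rightarrow> real"
    and \<epsilon> Y :: "nat \<Rightarrow> 'w \<Rightarrow> real"
    and K :: "real \<Rightarrow> real" and h u :: real and \<omega> :: 'w
    and U\<^sub>\<omega> Y\<^sub>\<omega> :: "nat \<Rightarrow> real" and X\<^sub>\<omega> :: "nat \<Rightarrow> nat \<Rightarrow> real"
  defines "U\<^sub>\<omega> \<equiv> (\<lambda>i. U i \<omega>)" and "X\<^sub>\<omega> \<equiv> (\<lambda>i k. X i k \<omega>)" and "Y\<^sub>\<omega> \<equiv> (\<lambda>i. Y i \<omega>)"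
  assumes "varying_coefficient_sample M n d a \<sigma> U X \<epsilon> Y"
    and "\<And>t. 0 \<le> K t" and "0 < h"
    and "\<omega> \<in> space M"
    and "g_hat n K h u U\<^sub>\<omega> \<noteq> 0"
    and "invertible_mat (gram_matrix n d p K h u U\<^sub>\<omega> X\<^sub>\<omega>)"
  shows "SST n K h u U\<^sub>\<omega> Y\<^sub>\<omega> =
           SSE n d p K h u U\<^sub>\<omega> X\<^sub>\<omega> Y\<^sub>\<omega> + SSR n d p K h u U\<^sub>\<omega> X\<^sub>\<omega> Y\<^sub>\<omega> \<and>
         (\<forall>i<n. Y_hat n d p K h u U\<^sub>\<omega> X\<^sub>\<omega> Y\<^sub>\<omega> i =
           (\<Sum>k<d. \<Sum>j\<le>p. beta_hat_coeff n d p K h u U\<^sub>\<omega> X\<^sub>\<omega> Y\<^sub>\<omega> k j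
                          * (U\<^sub>\<omega> i - u) ^ j * X\<^sub>\<omega> i k))"
proof -
  have "1 \<le> d"
    using assms(4) by (simp add: varying_coefficient_sample_def)
  moreover have "X\<^sub>\<omega> i 0 = 1" if "i < n" for i
    using assms(4,7) that by (simp add: varying_coefficient_sample_def X\<^sub>\<omega>_def)
  ultimately show ?thesis
    using SST_eq_SSE_plus_SSR[OF assms(9)] Y_hat_local_polynomial[OF assms(9)] assms(8) by blast
qed

end
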